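(* Let $X$ be a Banach space and let $T,K\in B[X]$. If $T$ is right semi-Fredholm and $K$ is compact, then $\overline{\mathcal R(T+K)}$ and $\mathcal N(T+K)$ are complemented subspaces of $X$, $\overline{\mathcal R(T^*+K^* )}$ and $\mathcal N(T^*+K^* )$ are complemented subspaces of $X^*$, and both $T+K$ and $T^*+K^*$ have closed range (in $X$ and $X^*$, respectively).
   Context: For a normed space $Y$, $B[Y]$ is the algebra of bounded linear operators on $Y$; a subspace of $Y$ means a norm-closed linear manifold of $Y$. A subspace $M$ of $Y$ is complemented in $Y$ if there is a subspace (norm-closed linear manifold) $N$ of $Y$ with $M+N=Y$ and $M\cap N=\{0\}$. For an operator $S$, $\mathcal R(S)$ and $\mathcal N(S)$ denote its range and kernel, and $\overline{\mathcal R(S)}$ is the norm closure of the range. $X^*$ is the (norm) dual of $X$, and the normed-space adjoint $T^*\in B[X^*]$ of $T\in B[X]$ is given by $T^*f=f\circ T$. An operator $T\in B[X]$ on a Banach space $X$ is right semi-Fredholm if it is right essentially invertible, i.e., there exist $S\in B[X]$ and a compact $C\in B[X]$ with $TS=I+C$. *)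

theory Defs
  imports "HOL-Analysis.Analysis"
begin

text \<open>
  Banach spaces over a general scalar field. The library classes only provide real scalars, so a
  normed space over \<open>'k\<close> is rendered as a real normed space together with a scalar multiplication by
  \<open>'k\<close> that extends the real one and for which the norm is homogeneous. By Ostrowski's theorem the
  members of class \<^class>\<open>real_normed_field\<close> are, up to isometric isomorphism, exactly the
  reals and the complex numbers. The real case is \<open>sc = scaleR\<close>, and any complex normed space
  arises by taking its underlying real normed space.
\<close>

locale normed_space_over = vector_space sc
  for sc :: "'k::real_normed_field \<Rightarrow> 'a::real_normed_vector \<Rightarrow> 'a" +
  assumes scale_of_real: "sc (of_real r) x = r *\<^sub>R x"
    and norm_scale: "norm (sc c x) = norm c * norm x"

text \<open>The algebra \<open>B[Y]\<close>; \<open>\<Rightarrow>\<^sub>L\<close> by itself only guarantees real linearity.\<close>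

definition bounded_operators ::
    "('k::real_normed_field \<Rightarrow> 'a::real_normed_vector \<Rightarrow> 'a) \<Rightarrow> ('a \<Rightarrow>\<^sub>L 'a) set" where
  "bounded_operators sc = {A. \<forall>c x. blinfun_apply A (sc c x) = sc c (blinfun_apply A x)}"

definition compact_operator :: "('a::real_normed_vector \<Rightarrow>\<^sub>L 'a) \<Rightarrow> bool" where
  "compact_operator A \<longleftrightarrow> (\<forall>S. bounded S \<longrightarrow> compact (closure (blinfun_apply A ` S)))"

definition right_semi_Fredholm ::
    "('k::real_normed_field \<Rightarrow> 'a::real_normed_vector \<Rightarrow> 'a) \<Rightarrow> ('a \<Rightarrow>\<^sub>L 'a) \<Rightarrow> bool" where
  "right_semi_Fredholm sc T \<longleftrightarrow>
     (\<exists>S \<in> bounded_operators sc. \<exists>C \<in> bounded_operators sc.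
        compact_operator C \<and> T o\<^sub>L S = id_blinfun + C)"

text \<open>
  The dual \<open>X\<^sup>*\<close> is a carrier set inside the type of bounded real-linear maps into \<open>'k\<close> (whose norm
  is the usual dual norm). The notions below therefore take the ambient space \<open>Y\<close> as an argument:
  \<open>Y = UNIV\<close> for \<open>X\<close>, and \<open>Y = dual_space sc\<close> for \<open>X\<^sup>*\<close>. The latter is closed
  (\<open>closed_dual_space\<close> below), so closedness and closure in \<open>Y\<close> agree with those in the type.
\<close>

definition dual_space ::
    "('k::real_normed_field \<Rightarrow> 'a::real_normed_vector \<Rightarrow> 'a) \<Rightarrow> ('a \<Rightarrow>\<^sub>L 'k) set" where
  "dual_space sc = {f. \<forall>c x. blinfun_apply f (sc c x) = c * blinfun_apply f x}"

definition dual_scale ::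
    "'k::real_normed_field \<Rightarrow> ('a::real_normed_vector \<Rightarrow>\<^sub>L 'k) \<Rightarrow> ('a \<Rightarrow>\<^sub>L 'k)" where
  "dual_scale c f = blinfun_mult_right c o\<^sub>L f"

lift_definition adjoint_operator ::
    "('a::real_normed_vector \<Rightarrow>\<^sub>L 'a) \<Rightarrow> ('a \<Rightarrow>\<^sub>L 'k::real_normed_field) \<Rightarrow>\<^sub>L ('a \<Rightarrow>\<^sub>L 'k)"
  is "\<lambda>T f. f o\<^sub>L T"
  by (rule bounded_bilinear.bounded_linear_left[OF bounded_bilinear_blinfun_compose])

definition range_on :: "'a set \<Rightarrow> ('a::real_normed_vector \<Rightarrow>\<^sub>L 'a) \<Rightarrow> 'a set" where
  "range_on Y A = blinfun_apply A ` Y"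

definition kernel_on :: "'a set \<Rightarrow> ('a::real_normed_vector \<Rightarrow>\<^sub>L 'a) \<Rightarrow> 'a set" where
  "kernel_on Y A = {x \<in> Y. A x = 0}"

definition closed_subspace ::
    "('k::real_normed_field \<Rightarrow> 'a::real_normed_vector \<Rightarrow> 'a) \<Rightarrow> 'a set \<Rightarrow> 'a set \<Rightarrow> bool" where
  "closed_subspace sc Y M \<longleftrightarrow> M \<subseteq> Y \<and> module.subspace sc M \<and> closed M"

definition complemented_subspace ::
    "('k::real_normed_field \<Rightarrow> 'a::real_normed_vector \<Rightarrow> 'a) \<Rightarrow> 'a set \<Rightarrow> 'a set \<Rightarrow> bool" where
  "complemented_subspace sc Y M \<longleftrightarrow>
     closed_subspace sc Y M \<and>
     (\<exists>N. closed_subspace sc Y N \<and> {x + y | x y. x \<in> M \<and> y \<in> N} = Y \<and> M \<inter> N = {0})"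

lemma dual_scale_apply [simp]: "dual_scale c f x = c * f x"
  by (simp add: dual_scale_def)

lemma adjoint_operator_apply [simp]: "adjoint_operator T f = f o\<^sub>L T"
  by (simp add: adjoint_operator.rep_eq)

lemma normed_space_over_scaleR:
  "normed_space_over (scaleR :: real \<Rightarrow> 'a::real_normed_vector \<Rightarrow> 'a)"
  by unfold_locales (auto simp: algebra_simps)

lemma normed_space_over_dual_scale:
  "normed_space_over
     (dual_scale :: 'k::real_normed_field \<Rightarrow> ('a::real_normed_vector \<Rightarrow>\<^sub>L 'k) \<Rightarrow> ('a \<Rightarrow>\<^sub>L 'k))"
proof unfold_locales
  fix c :: 'k and f :: "'a \<Rightarrow>\<^sub>L 'k"
  have le: "norm (dual_scale d g) \<le> norm d * norm g" for d :: 'k and g :: "'a \<Rightarrow>\<^sub>L 'k"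
    by (rule norm_blinfun_bound)
      (auto simp: norm_mult mult.assoc intro!: mult_left_mono norm_blinfun)
  show "norm (dual_scale c f) = norm c * norm f"
  proof (cases "c = 0")
    case True
    then show ?thesis using le[of c f] by simp
  next
    case False
    have "dual_scale (inverse c) (dual_scale c f) = f"
      by (rule blinfun_eqI) (simp add: False)
    with le[of "inverse c" "dual_scale c f"]
    have "norm f \<le> inverse (norm c) * norm (dual_scale c f)"
      by (simp only: norm_inverse)
    with False have "norm c * norm f \<le> norm (dual_scale c f)"
      by (simp add: field_simps)
    with le[of c f] show ?thesis by simp
  qed
qed (auto intro!: blinfun_eqI simp: algebra_simps blinfun.bilinear_simps scaleR_conv_of_real)

lemma closed_dual_space: "closed (dual_space sc)"
proof -
  have "dual_space sc = (\<Inter>c. \<Inter>x. {f. blinfun_apply f (sc c x) = c * blinfun_apply f x})"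
    by (auto simp: dual_space_def)
  moreover have "closed {f. blinfun_apply f (sc c x) = c * blinfun_apply f x}" for c x
    by (intro closed_Collect_eq continuous_intros)
  ultimately show ?thesis by (simp add: closed_INT)
qed

lemma subspace_dual_space: "module.subspace dual_scale (dual_space sc)"
proof -
  interpret normed_space_over dual_scale by (rule normed_space_over_dual_scale)
  show ?thesis
    unfolding subspace_def dual_space_def
    by (auto simp: blinfun.bilinear_simps algebra_simps)
qed

lemma adjoint_operator_dual_space:
  "T \<in> bounded_operators sc \<Longrightarrow> f \<in> dual_space sc \<Longrightarrow> adjoint_operator T f \<in> dual_space sc"
  by (auto simp: bounded_operators_def dual_space_def)

lemma adjoint_operator_bounded_operators: "adjoint_operator T \<in> bounded_operators dual_scale"
  by (auto simp: bounded_operators_def intro!: blinfun_eqI)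

end

theory Submission
  imports Defs
begin

text \<open>
  The theorem follows once \<open>A = T + K\<close> has a generalized inverse: a bounded operator \<open>G\<close>, linear over
  the scalar field, with \<open>A G A = A\<close>. Then \<open>A G\<close> is idempotent with range \<open>\<R>(A)\<close>
  and \<open>G A\<close> is idempotent with kernel \<open>\<N>(A)\<close>, so both subspaces are closed and
  complemented. Taking adjoints in \<open>A G A = A\<close> gives \<open>A\<^sup>* G\<^sup>* A\<^sup>* = A\<^sup>*\<close>, so the same argument applies to
  \<open>A\<^sup>*\<close> on the dual.

  To find \<open>G\<close>, let \<open>T S = I + C\<^sub>0\<close> with \<open>C\<^sub>0\<close> compact; then \<open>A S = I + C\<close> with \<open>C = C\<^sub>0 + K S\<close> compact.
  Riesz theory produces an operator \<open>V\<close> for which \<open>P = I - (I + C) V\<close> has finite-dimensional range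
  (\<open>parametrix_id_plus_compact\<close>): for large \<open>n\<close> the space is the direct sum of the null space and the
  range of \<open>M = (I + C)\<^sup>n\<close>, \<open>M\<close> is boundedly invertible on its range, and \<open>P\<close> can be taken to be the
  projection onto the null space of \<open>M\<close>. Since \<open>A S V = I - P\<close>, the operator \<open>S V\<close> inverts \<open>A\<close> up to
  \<open>P\<close>. Choose any linear \<open>g\<close>, bounded or not, with \<open>A g v = v\<close> for all \<open>v \<in> \<R>(A)\<close>. Then
  \<open>g P\<close> is bounded, because \<open>P\<close> has finite-dimensional range, and \<open>G = S V + g P\<close> is a generalized
  inverse (\<open>generalized_inverse_exists\<close>): for \<open>v \<in> \<R>(A)\<close> also \<open>P v = v - A S V v\<close> lies in
  \<open>\<R>(A)\<close>, so \<open>A G v = (v - P v) + P v = v\<close>.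

  The Riesz theory is carried out for the underlying real structure: subspaces, spans and finite
  dimension are real there. Linearity over the scalar field is then checked for each operator
  that is constructed.
\<close>

section \<open>Compact operators\<close>

lemma compact_operatorI:
  assumes "\<And>S. bounded S \<Longrightarrow> \<exists>Z. compact Z \<and> blinfun_apply A ` S \<subseteq> Z"
  shows "compact_operator A"
  unfolding compact_operator_def
proof (intro allI impI)
  fix S :: "'a set" assume "bounded S"
  then obtain Z where Z: "compact Z" "blinfun_apply A ` S \<subseteq> Z" using assms by blast
  have "closure (blinfun_apply A ` S) \<subseteq> Z"
    using Z by (simp add: closure_minimal compact_imp_closed)
  then show "compact (closure (blinfun_apply A ` S))"
    using compact_Int_closed[OF Z(1) closed_closure, of "blinfun_apply A ` S"]
    by (simp add: inf.absorb2)
qed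

lemma compact_operator_add:
  assumes "compact_operator A" "compact_operator B"
  shows "compact_operator (A + B)"
proof (rule compact_operatorI)
  fix S :: "'a set" assume "bounded S"
  then have "compact (closure (blinfun_apply A ` S))" "compact (closure (blinfun_apply B ` S))"
    using assms by (auto simp: compact_operator_def)
  then have "compact {x + y | x y. x \<in> closure (blinfun_apply A ` S) \<and> y \<in> closure (blinfun_apply B ` S)}"
    by (rule compact_sums)
  moreover have "blinfun_apply (A + B) ` S
      \<subseteq> {x + y | x y. x \<in> closure (blinfun_apply A ` S) \<and> y \<in> closure (blinfun_apply B ` S)}"
    using closure_subset[of "blinfun_apply A ` S"] closure_subset[of "blinfun_apply B ` S"]
    by (force simp: blinfun.add_left)
  ultimately show "\<exists>Z. compact Z \<and> blinfun_apply (A + B) ` S \<subseteq> Z" by blast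
qed

lemma compact_operator_compose:
  assumes "compact_operator A"
  shows "compact_operator (A o\<^sub>L B)"
proof (rule compact_operatorI)
  fix S :: "'a set" assume "bounded S"
  then have "bounded (blinfun_apply B ` S)"
    by (rule bounded_linear_image) (rule blinfun.bounded_linear_right)
  then have "compact (closure (blinfun_apply A ` blinfun_apply B ` S))"
    using assms by (auto simp: compact_operator_def)
  moreover have "blinfun_apply (A o\<^sub>L B) ` S \<subseteq> closure (blinfun_apply A ` blinfun_apply B ` S)"
    using closure_subset[of "blinfun_apply A ` blinfun_apply B ` S"] by (simp add: image_image)
  ultimately show "\<exists>Z. compact Z \<and> blinfun_apply (A o\<^sub>L B) ` S \<subseteq> Z" by blast
qed

lemma compact_operator_zero: "compact_operator 0"
  by (rule compact_operatorI) (rule exI[of _ "{0}"], auto)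

lemma compact_operator_convergent_subsequence:
  fixes C :: "'a::real_normed_vector \<Rightarrow>\<^sub>L 'a" and x :: "nat \<Rightarrow> 'a"
  assumes "compact_operator C" "bounded (range x)"
  obtains l r where "strict_mono r" "(\<lambda>n. blinfun_apply C (x (r n))) \<longlonglongrightarrow> l"
proof -
  have "seq_compact (closure (blinfun_apply C ` range x))"
    using assms by (auto simp: compact_operator_def compact_eq_seq_compact_metric)
  moreover have "\<forall>n. blinfun_apply C (x n) \<in> closure (blinfun_apply C ` range x)"
    using closure_subset[of "blinfun_apply C ` range x"] by blast
  ultimately obtain l r where "strict_mono r" "((\<lambda>n. blinfun_apply C (x n)) \<circ> r) \<longlonglongrightarrow> l"
    using seq_compactE[of _ "\<lambda>n. blinfun_apply C (x n)"] by blast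
  then show thesis using that by (auto simp: o_def)
qed

lemma compact_operator_no_separated_image:
  fixes C :: "'a::real_normed_vector \<Rightarrow>\<^sub>L 'a"
  assumes C: "compact_operator C" and x: "bounded (range x)"
    and sep: "\<And>m n::nat. m < n \<Longrightarrow> e \<le> norm (C (x n) - C (x m))" and e: "0 < e"
  shows False
proof -
  obtain l r where r: "strict_mono r" and l: "(\<lambda>n. blinfun_apply C (x (r n))) \<longlonglongrightarrow> l"
    using compact_operator_convergent_subsequence[OF C x] by blast
  have "Cauchy (\<lambda>n. blinfun_apply C (x (r n)))" using l by (rule LIMSEQ_imp_Cauchy)
  then obtain N where "\<And>m n. m \<ge> N \<Longrightarrow> n \<ge> N \<Longrightarrow> norm (C (x (r m)) - C (x (r n))) < e"
    using e by (meson CauchyD)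
  then have "norm (C (x (r (Suc N))) - C (x (r N))) < e" by simp
  moreover have "e \<le> norm (C (x (r (Suc N))) - C (x (r N)))"
    using r by (intro sep) (simp add: strict_mono_def)
  ultimately show False by simp
qed

text \<open>
  If \<open>x\<^sub>n + C x\<^sub>n\<close> converges and \<open>x\<^sub>n\<close> is bounded, then \<open>C x\<^sub>n\<close> converges along a subsequence, hence so
  does \<open>x\<^sub>n\<close> itself, and its limit is mapped to that of \<open>x\<^sub>n + C x\<^sub>n\<close>.
\<close>

lemma closed_image_id_plus_compact:
  fixes C :: "'a::real_normed_vector \<Rightarrow>\<^sub>L 'a"
  assumes C: "compact_operator C" and F: "closed F" "bounded F"
  shows "closed ((\<lambda>x. x + C x) ` F)"
  unfolding closed_sequential_limits
proof (intro allI impI, elim conjE)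
  fix y l assume y: "\<forall>n. y n \<in> (\<lambda>x. x + C x) ` F" and l: "y \<longlonglongrightarrow> l"
  then have "\<forall>n. \<exists>x. x \<in> F \<and> y n = x + C x" by blast
  then obtain x where x: "\<And>n. x n \<in> F" "\<And>n. y n = x n + C (x n)" by metis
  have "bounded (range x)" using F(2) x(1) by (meson bounded_subset image_subsetI)
  then obtain k r where r: "strict_mono r" and k: "(\<lambda>n. blinfun_apply C (x (r n))) \<longlonglongrightarrow> k"
    using compact_operator_convergent_subsequence[OF C] by blast
  have "(\<lambda>n. y (r n) - C (x (r n))) \<longlonglongrightarrow> l - k"
    using LIMSEQ_subseq_LIMSEQ[OF l r] k by (intro tendsto_diff) (auto simp: o_def)
  then have lim: "(\<lambda>n. x (r n)) \<longlonglongrightarrow> l - k" using x(2) by simp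
  then have mem: "l - k \<in> F" using F(1) x(1) by (meson closed_sequentially)
  have "(\<lambda>n. C (x (r n))) \<longlonglongrightarrow> C (l - k)"
    using lim by (intro tendsto_intros)
  then have "k = C (l - k)" using k LIMSEQ_unique by blast
  then have "l = (l - k) + C (l - k)" by simp
  with mem show "l \<in> (\<lambda>x. x + C x) ` F" by blast
qed

lemma id_plus_compact_bounded_below:
  fixes C :: "'a::real_normed_vector \<Rightarrow>\<^sub>L 'a"
  assumes C: "compact_operator C" and F: "closed F" "bounded F"
    and nz: "\<And>x. x \<in> F \<Longrightarrow> x + C x \<noteq> 0"
  obtains c where "0 < c" "\<And>x. x \<in> F \<Longrightarrow> c \<le> norm (x + C x)"
proof (cases "F = {}")
  case True then show thesis using that[of 1] by simp
next
  case False
  let ?Z = "(\<lambda>x. x + C x) ` F"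
  have "0 < infdist 0 ?Z"
    using closed_image_id_plus_compact[OF C F] False nz
    by (intro infdist_pos_not_in_closed) auto
  moreover have "infdist 0 ?Z \<le> norm (x + C x)" if "x \<in> F" for x
    using infdist_le[of "x + C x" ?Z 0] that by (simp only: image_eqI dist_0_norm)
  ultimately show thesis using that by blast
qed

section \<open>Riesz's lemma and chains of subspaces\<close>

lemma near_best_approximation:
  fixes M :: "'a::real_normed_vector set"
  assumes M: "closed M" "M \<noteq> {}" and x: "x \<notin> M"
  obtains z where "z \<in> M" "z \<noteq> x" "\<And>m. m \<in> M \<Longrightarrow> norm (x - z) \<le> 2 * norm (x - m)"
proof -
  have pos: "0 < infdist x M" using M x by (simp add: infdist_pos_not_in_closed)
  then have "(INF a\<in>M. dist x a) < 2 * infdist x M" using M by (simp add: infdist_def)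
  then obtain z where z: "z \<in> M" "dist x z < 2 * infdist x M"
    using cINF_less_iff[of M "dist x"] M(2) by (auto intro: bdd_belowI2[where m=0])
  show thesis
  proof (rule that[OF z(1)])
    show "z \<noteq> x" using z x by auto
    show "norm (x - z) \<le> 2 * norm (x - m)" if "m \<in> M" for m
      using z(2) infdist_le[OF that, of x] by (simp add: dist_norm)
  qed
qed

text \<open>
  A unit vector at distance at least \<open>1/2\<close> from \<open>M\<close>, obtained by normalizing the error of a
  nearly best approximation \<open>z\<close> of \<open>x\<close>. The vector is kept in the explicit form \<open>t (x - z)\<close> because
  the closed range argument needs its relation to \<open>x\<close>.
\<close>

lemma Riesz_lemma:
  fixes M :: "'a::real_normed_vector set"
  assumes M: "closed M" "subspace M" and x: "x \<notin> M"
  obtains z t where "z \<in> M" "0 < t" "t * norm (x - z) = 1"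
    "\<And>m. m \<in> M \<Longrightarrow> 1/2 \<le> norm (t *\<^sub>R (x - z) - m)"
proof -
  have "M \<noteq> {}" using M(2) subspace_0 by auto
  with M x obtain z where z: "z \<in> M" "z \<noteq> x"
      and far: "\<And>m. m \<in> M \<Longrightarrow> norm (x - z) \<le> 2 * norm (x - m)"
    by (metis near_best_approximation)
  define t where "t = inverse (norm (x - z))"
  have t: "t > 0" "t * norm (x - z) = 1" using z by (auto simp: t_def)
  show thesis
  proof (rule that[OF z(1) t])
    fix m assume m: "m \<in> M"
    have "z + norm (x - z) *\<^sub>R m \<in> M" using M(2) m z by (simp add: subspace_add subspace_scale)
    then have "norm (x - z) \<le> 2 * norm (x - (z + norm (x - z) *\<^sub>R m))" by (rule far)
    then have "t * norm (x - z) \<le> t * (2 * norm (x - (z + norm (x - z) *\<^sub>R m)))"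
      using t(1) by (simp add: mult_left_mono)
    also have "\<dots> = 2 * norm (t *\<^sub>R (x - (z + norm (x - z) *\<^sub>R m)))" using t(1) by simp
    also have "t *\<^sub>R (x - (z + norm (x - z) *\<^sub>R m)) = t *\<^sub>R (x - z) - (t * norm (x - z)) *\<^sub>R m"
      by (simp add: algebra_simps)
    finally show "1/2 \<le> norm (t *\<^sub>R (x - z) - m)" using t(2) by simp
  qed
qed

lemma Riesz_lemma_nested:
  fixes M N :: "'a::real_normed_vector set"
  assumes "closed M" "subspace M" "subspace N" "M \<subset> N"
  obtains u where "u \<in> N" "norm u = 1" "\<And>m. m \<in> M \<Longrightarrow> 1/2 \<le> norm (u - m)"
proof -
  obtain x where x: "x \<in> N" "x \<notin> M" using assms(4) by blast
  obtain z t where z: "z \<in> M" and t: "0 < t" "t * norm (x - z) = 1"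
    and far: "\<And>m. m \<in> M \<Longrightarrow> 1/2 \<le> norm (t *\<^sub>R (x - z) - m)"
    by (rule Riesz_lemma[OF assms(1,2) x(2)]) blast
  show thesis
  proof (rule that[OF _ _ far])
    show "t *\<^sub>R (x - z) \<in> N"
      using x(1) z assms(3,4) by (intro subspace_scale subspace_diff) auto
    show "norm (t *\<^sub>R (x - z)) = 1" using t by simp
  qed
qed

text \<open>
  In a strictly increasing chain, Riesz's lemma gives unit vectors \<open>u\<^sub>n \<in> M\<^sub>n\<^sub>+\<^sub>1\<close> far from \<open>M\<^sub>n\<close>. As \<open>I + C\<close>
  moves the chain down by one step, \<open>C u\<^sub>n\<close> is \<open>- u\<^sub>n\<close> up to an element of \<open>M\<^sub>n\<close>, while \<open>C u\<^sub>m\<close> lies in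
  \<open>M\<^sub>n\<close> for \<open>m < n\<close>. So the vectors \<open>C u\<^sub>n\<close> stay apart, against compactness.
\<close>

lemma ascending_chain_stabilizes:
  fixes C :: "'a::real_normed_vector \<Rightarrow>\<^sub>L 'a"
  assumes C: "compact_operator C"
    and M: "\<And>n. closed (M n)" "\<And>n. subspace (M n)" "\<And>n. M n \<subseteq> M (Suc n)"
    and shift: "\<And>n x. x \<in> M (Suc n) \<Longrightarrow> x + C x \<in> M n"
  shows "\<exists>n. M (Suc n) = M n"
proof (rule ccontr)
  assume "\<nexists>n. M (Suc n) = M n"
  then have "M n \<subset> M (Suc n)" for n using M(3) by blast
  then have "\<forall>n. \<exists>u. u \<in> M (Suc n) \<and> norm u = 1 \<and> (\<forall>m\<in>M n. 1/2 \<le> norm (u - m))"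
    using Riesz_lemma_nested[OF M(1,2,2)] by metis
  then obtain u where u: "\<And>n. u n \<in> M (Suc n)" "\<And>n. norm (u n) = 1"
      "\<And>n m. m \<in> M n \<Longrightarrow> 1/2 \<le> norm (u n - m)" by metis
  show False
  proof (rule compact_operator_no_separated_image[OF C])
    show "bounded (range u)" using u(2) by (auto intro!: boundedI[where B=1])
    fix m n :: nat assume "m < n"
    then have "M (Suc m) \<subseteq> M n" using lift_Suc_mono_le[of M] M(3) by auto
    then have um: "u m \<in> M n" using u(1) by blast
    have "M n \<subseteq> M (Suc n)" by (rule M)
    then have "u m + C (u m) \<in> M n" using um shift by blast
    then have "((u n + C (u n)) - (u m + C (u m))) + u m \<in> M n"
      using um shift[OF u(1)] M(2) by (meson subspace_add subspace_diff)
    from u(3)[OF this] show "1/2 \<le> norm (C (u n) - C (u m))"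
      by (simp add: norm_minus_commute)
  qed simp
qed

text \<open>
  The same argument with the roles of the indices exchanged: for \<open>m < n\<close> the vectors \<open>u\<^sub>n\<close> and \<open>C u\<^sub>n\<close> lie in
  \<open>M\<^sub>m\<^sub>+\<^sub>1\<close>, from which \<open>u\<^sub>m\<close> has distance at least \<open>1/2\<close>.
\<close>

lemma descending_chain_stabilizes:
  fixes C :: "'a::real_normed_vector \<Rightarrow>\<^sub>L 'a"
  assumes C: "compact_operator C"
    and M: "\<And>n. closed (M n)" "\<And>n. subspace (M n)" "\<And>n. M (Suc n) \<subseteq> M n"
    and shift: "\<And>n x. x \<in> M n \<Longrightarrow> x + C x \<in> M (Suc n)"
  shows "\<exists>n. M (Suc n) = M n"
proof (rule ccontr)
  assume "\<nexists>n. M (Suc n) = M n"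
  then have "M (Suc n) \<subset> M n" for n using M(3) by blast
  then have "\<forall>n. \<exists>u. u \<in> M n \<and> norm u = 1 \<and> (\<forall>m\<in>M (Suc n). 1/2 \<le> norm (u - m))"
    using Riesz_lemma_nested[OF M(1,2,2)] by metis
  then obtain u where u: "\<And>n. u n \<in> M n" "\<And>n. norm (u n) = 1"
      "\<And>n m. m \<in> M (Suc n) \<Longrightarrow> 1/2 \<le> norm (u n - m)" by metis
  show False
  proof (rule compact_operator_no_separated_image[OF C])
    show "bounded (range u)" using u(2) by (auto intro!: boundedI[where B=1])
    fix m n :: nat assume "m < n"
    then have "M n \<subseteq> M (Suc m)" using lift_Suc_antimono_le[of M] M(3) by auto
    then have un: "u n \<in> M (Suc m)" using u(1) by blast
    have "M (Suc (Suc m)) \<subseteq> M (Suc m)" by (rule M)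
    then have "u n + C (u n) \<in> M (Suc m)" using un shift by blast
    then have "((u m + C (u m)) - (u n + C (u n))) + u n \<in> M (Suc m)"
      using un shift[OF u(1)] M(2) by (meson subspace_add subspace_diff)
    from u(3)[OF this] show "1/2 \<le> norm (C (u n) - C (u m))"
      by (simp add: norm_minus_commute)
  qed simp
qed

section \<open>Null space and range of a compact perturbation of the identity\<close>

lemma closed_null_space_id_plus:
  fixes C :: "'a::real_normed_vector \<Rightarrow>\<^sub>L 'a"
  shows "closed {x. x + C x = 0}"
  by (intro closed_Collect_eq continuous_intros)

lemma subspace_null_space_id_plus:
  fixes C :: "'a::real_normed_vector \<Rightarrow>\<^sub>L 'a"
  shows "subspace {x. x + C x = 0}"
proof -
  have "x + y + (C x + C y) = 0" if "x + C x = 0" "y + C y = 0" for x y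
    using that by (metis add.assoc add.left_commute add.right_neutral)
  then show ?thesis
    by (auto simp: subspace_def blinfun.bilinear_simps simp flip: scaleR_add_right)
qed

text \<open>
  Every point of the range has a preimage \<open>w\<close> with \<open>c \<parallel>w\<parallel> \<le> \<parallel>w + C w\<parallel>\<close>, where \<open>c\<close> is a lower
  bound of \<open>\<parallel>u + C u\<parallel>\<close> over unit vectors \<open>u\<close> far from the null space. A convergent sequence in
  the range therefore lies in the image of one ball, and that image is closed.
\<close>

lemma closed_range_id_plus_compact:
  fixes C :: "'a::real_normed_vector \<Rightarrow>\<^sub>L 'a"
  assumes C: "compact_operator C"
  shows "closed (range (\<lambda>x. x + C x))"
proof -
  let ?N = "{x. x + C x = 0}"
  let ?F = "{u. norm u = 1} \<inter> (\<Inter>m\<in>?N. {u. 1/2 \<le> norm (u - m)})"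
  have "closed ?F"
    by (intro closed_Int closed_INT ballI closed_Collect_le closed_Collect_eq continuous_intros)
  moreover have "bounded ?F" by (rule bounded_subset[OF bounded_cball[of 0 1]]) auto
  moreover have "x + C x \<noteq> 0" if "x \<in> ?F" for x
  proof
    assume "x + C x = 0"
    then have "1/2 \<le> norm (x - x)" using that by blast
    then show False by simp
  qed
  ultimately obtain c where c: "0 < c" and below: "\<And>x. x \<in> ?F \<Longrightarrow> c \<le> norm (x + C x)"
    using id_plus_compact_bounded_below[OF C] by blast
  have preimage: "\<exists>w. w + C w = x + C x \<and> c * norm w \<le> norm (x + C x)" for x
  proof (cases "x \<in> ?N")
    case True then show ?thesis by (intro exI[of _ 0]) simp
  next
    case False
    obtain z t where z: "z \<in> ?N" "0 < t" "t * norm (x - z) = 1"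
      "\<And>m. m \<in> ?N \<Longrightarrow> 1/2 \<le> norm (t *\<^sub>R (x - z) - m)"
      by (rule Riesz_lemma[OF closed_null_space_id_plus subspace_null_space_id_plus False]) blast
    have eq: "(x - z) + C (x - z) = x + C x"
    proof -
      have diff: "(x - z) + C (x - z) = (x + C x) - (z + C z)" by (simp add: blinfun.diff_right)
      have "z + C z = 0" using z(1) by blast
      then show ?thesis by (simp only: diff diff_zero)
    qed
    have "t *\<^sub>R (x - z) + C (t *\<^sub>R (x - z)) = t *\<^sub>R (x + C x)"
      using arg_cong[OF eq, of "scaleR t"] by (simp only: blinfun.scaleR_right scaleR_add_right)
    moreover have "t *\<^sub>R (x - z) \<in> ?F" using z by auto
    ultimately have "c \<le> t * norm (x + C x)" using below[of "t *\<^sub>R (x - z)"] z(2) by simp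
    then have "c * norm (x - z) \<le> (t * norm (x + C x)) * norm (x - z)"
      by (intro mult_right_mono) auto
    also have "\<dots> = (t * norm (x - z)) * norm (x + C x)" by simp
    also have "\<dots> = norm (x + C x)" using z(3) by simp
    finally show ?thesis using eq by blast
  qed
  show ?thesis
    unfolding closed_sequential_limits
  proof (intro allI impI, elim conjE)
    fix y l assume y: "\<forall>n. y n \<in> range (\<lambda>x. x + C x)" and l: "y \<longlonglongrightarrow> l"
    obtain b where b: "\<And>n. norm (y n) \<le> b"
      using convergent_imp_bounded[OF l] by (auto simp: bounded_iff)
    have "y n \<in> (\<lambda>x. x + C x) ` cball 0 (b / c)" for n
    proof -
      obtain x where "y n = x + C x" using y by blast
      then obtain w where w: "y n = w + C w" "c * norm w \<le> norm (y n)"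
        using preimage[of x] by metis
      then have "norm w \<le> b / c" using b[of n] c by (simp add: field_simps)
      then show ?thesis using w by auto
    qed
    moreover have "closed ((\<lambda>x. x + C x) ` cball 0 (b / c))"
      by (intro closed_image_id_plus_compact[OF C]) auto
    ultimately have "l \<in> (\<lambda>x. x + C x) ` cball 0 (b / c)"
      using l closed_sequentially by blast
    then show "l \<in> range (\<lambda>x. x + C x)" by blast
  qed
qed

section \<open>Finite-dimensional subspaces of normed spaces\<close>

text \<open>
  The distance from \<open>k b + m\<close> to \<open>M\<close> is \<open>\<bar>k\<bar>\<close> times the distance from \<open>b\<close> to \<open>M\<close>. Both facts about
  finite spans below are inductions that add one vector at a time and control its coefficient this way.
\<close>

lemma coefficient_bound_off_subspace:
  fixes M :: "'a::real_normed_vector set"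
  assumes M: "closed M" "subspace M" and b: "b \<notin> M"
  obtains c where "0 \<le> c" "\<And>k m. m \<in> M \<Longrightarrow> \<bar>k\<bar> \<le> c * norm (k *\<^sub>R b + m)"
proof -
  have "M \<noteq> {}" using M(2) subspace_0 by auto
  then have d: "0 < infdist b M" using M b by (simp add: infdist_pos_not_in_closed)
  show thesis
  proof (rule that[of "inverse (infdist b M)"])
    fix k m assume m: "m \<in> M"
    show "\<bar>k\<bar> \<le> inverse (infdist b M) * norm (k *\<^sub>R b + m)"
    proof (cases "k = 0")
      case False
      have "- (inverse k *\<^sub>R m) \<in> M" using m M(2) by (simp add: subspace_neg subspace_scale)
      then have "infdist b M \<le> norm (b + inverse k *\<^sub>R m)"
        using infdist_le[of "- (inverse k *\<^sub>R m)" M b] by (simp add: dist_norm)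
      then have "\<bar>k\<bar> * infdist b M \<le> \<bar>k\<bar> * norm (b + inverse k *\<^sub>R m)"
        by (simp add: mult_left_mono)
      also have "\<dots> = norm (k *\<^sub>R (b + inverse k *\<^sub>R m))" by simp
      also have "k *\<^sub>R (b + inverse k *\<^sub>R m) = k *\<^sub>R b + m" using False by (simp add: algebra_simps)
      finally show ?thesis using d by (simp add: field_simps)
    qed (use d in simp)
  qed (use d in simp)
qed

lemma closed_extension_by_vector:
  fixes M :: "'a::real_normed_vector set"
  assumes M: "closed M" "subspace M" and b: "b \<notin> M"
  shows "closed {x. \<exists>k. x - k *\<^sub>R b \<in> M}"
  unfolding closed_sequential_limits
proof (intro allI impI, elim conjE)
  fix x l assume "\<forall>n. x n \<in> {x. \<exists>k. x - k *\<^sub>R b \<in> M}" and l: "x \<longlonglongrightarrow> l"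
  then obtain k where k: "\<And>n. x n - k n *\<^sub>R b \<in> M" by (auto simp: choice_iff)
  obtain c where c: "0 \<le> c" "\<And>k m. m \<in> M \<Longrightarrow> \<bar>k\<bar> \<le> c * norm (k *\<^sub>R b + m)"
    using coefficient_bound_off_subspace[OF M b] by blast
  have diff: "\<bar>k m - k n\<bar> \<le> c * norm (x m - x n)" for m n
  proof -
    have "(x m - k m *\<^sub>R b) - (x n - k n *\<^sub>R b) \<in> M" using k M(2) by (simp add: subspace_diff)
    from c(2)[OF this, of "k m - k n"] show ?thesis by (simp add: algebra_simps)
  qed
  have "Cauchy k"
  proof (rule CauchyI)
    fix e :: real assume e: "0 < e"
    have "Cauchy x" using l by (rule LIMSEQ_imp_Cauchy)
    then obtain N where N: "\<And>m n. m \<ge> N \<Longrightarrow> n \<ge> N \<Longrightarrow> norm (x m - x n) < e / (c + 1)"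
      using e c(1) CauchyD[of x "e / (c + 1)"] by (auto simp: add_nonneg_pos)
    have "norm (k m - k n) < e" if "m \<ge> N" "n \<ge> N" for m n
    proof -
      have "\<bar>k m - k n\<bar> \<le> (c + 1) * norm (x m - x n)"
        using diff[of m n] norm_ge_zero[of "x m - x n"] unfolding distrib_right by linarith
      also have "\<dots> < e" using N[OF that] c(1) by (simp add: field_simps)
      finally show ?thesis by simp
    qed
    then show "\<exists>N. \<forall>m\<ge>N. \<forall>n\<ge>N. norm (k m - k n) < e" by blast
  qed
  then obtain t where t: "k \<longlonglongrightarrow> t" using Cauchy_convergent_iff convergent_def by blast
  have "(\<lambda>n. x n - k n *\<^sub>R b) \<longlonglongrightarrow> l - t *\<^sub>R b" by (intro tendsto_intros l t)
  then have "l - t *\<^sub>R b \<in> M" using M(1) k by (meson closed_sequentially)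
  then show "l \<in> {x. \<exists>k. x - k *\<^sub>R b \<in> M}" by blast
qed

lemma closed_span_finite:
  fixes B :: "'a::real_normed_vector set"
  assumes "finite B"
  shows "closed (span B)"
  using assms
proof induction
  case (insert b B)
  show ?case
  proof (cases "b \<in> span B")
    case False
    then show ?thesis
      using closed_extension_by_vector[OF insert.IH subspace_span, of b] by (simp add: span_insert)
  qed (use insert in \<open>simp add: span_redundant\<close>)
qed simp

lemma linear_bounded_on_finite_span:
  fixes f :: "'a::real_normed_vector \<Rightarrow> 'b::real_normed_vector"
  assumes "finite B" and f: "linear f"
  obtains c where "0 \<le> c" "\<And>x. x \<in> span B \<Longrightarrow> norm (f x) \<le> c * norm x"
proof -
  from assms(1) have "\<exists>c\<ge>0. \<forall>x\<in>span B. norm (f x) \<le> c * norm x"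
  proof induction
    case empty
    then show ?case using linear_0[OF f] by auto
  next
    case (insert b B)
    then obtain c where c: "0 \<le> c" "\<And>x. x \<in> span B \<Longrightarrow> norm (f x) \<le> c * norm x" by blast
    show ?case
    proof (cases "b \<in> span B")
      case False
      obtain d where d: "0 \<le> d" "\<And>k m. m \<in> span B \<Longrightarrow> \<bar>k\<bar> \<le> d * norm (k *\<^sub>R b + m)"
        using coefficient_bound_off_subspace[OF closed_span_finite[OF insert.hyps(1)] subspace_span False]
        by blast
      have "norm (f x) \<le> (d * norm (f b) + c * (1 + d * norm b)) * norm x"
        if "x \<in> span (insert b B)" for x
      proof -
        obtain k where k: "x - k *\<^sub>R b \<in> span B" using \<open>x \<in> span (insert b B)\<close> by (auto simp: span_insert)
        have kx: "\<bar>k\<bar> \<le> d * norm x" using d(2)[OF k, of k] by simp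
        have "f x = k *\<^sub>R f b + f (x - k *\<^sub>R b)"
          by (simp add: linear_diff[OF f] linear_scale[OF f])
        then have "norm (f x) \<le> \<bar>k\<bar> * norm (f b) + norm (f (x - k *\<^sub>R b))"
          by (metis norm_scaleR norm_triangle_ineq)
        also have "\<dots> \<le> \<bar>k\<bar> * norm (f b) + c * norm (x - k *\<^sub>R b)" using c(2)[OF k] by simp
        also have "\<dots> \<le> \<bar>k\<bar> * norm (f b) + c * (norm x + \<bar>k\<bar> * norm b)"
          using c(1) norm_triangle_ineq4[of x "k *\<^sub>R b"] by (simp add: mult_left_mono)
        also have "\<dots> \<le> (d * norm x) * norm (f b) + c * (norm x + (d * norm x) * norm b)"
          using kx c(1) by (intro add_mono mult_mono order_refl) auto
        also have "\<dots> = (d * norm (f b) + c * (1 + d * norm b)) * norm x"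
          by (simp add: algebra_simps)
        finally show ?thesis .
      qed
      moreover have "0 \<le> d * norm (f b) + c * (1 + d * norm b)" using c(1) d(1) by simp
      ultimately show ?thesis by blast
    qed (use c in \<open>auto simp: span_redundant\<close>)
  qed
  then show thesis using that by blast
qed

text \<open>
  Were the null space not finitely spanned, it would contain a strictly increasing chain of
  finite-dimensional spans. As \<open>I + C\<close> vanishes on the null space, it maps each member of the chain into the
  previous one, and the stabilization of ascending chains applies.
\<close>

lemma finite_dimensional_null_space_id_plus_compact:
  fixes C :: "'a::real_normed_vector \<Rightarrow>\<^sub>L 'a"
  assumes C: "compact_operator C"
  shows "\<exists>B. finite B \<and> {x. x + C x = 0} \<subseteq> span B"
proof (rule ccontr)
  let ?N = "{x. x + C x = 0}"
  assume "\<not> ?thesis"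
  then have ext: "\<exists>x. x \<in> ?N \<and> x \<notin> span B" if "finite B" for B using that by blast
  have "\<exists>F. \<forall>n::nat. (finite (F n) \<and> F n \<subseteq> ?N) \<and> (F n \<subseteq> F (Suc n) \<and> \<not> F (Suc n) \<subseteq> span (F n))"
  proof (rule dependent_nat_choice)
    show "\<exists>B. finite B \<and> B \<subseteq> ?N" by blast
    fix B assume B: "finite B \<and> B \<subseteq> ?N"
    then obtain x where "x \<in> ?N" "x \<notin> span B" using ext by blast
    with B show "\<exists>B'. (finite B' \<and> B' \<subseteq> ?N) \<and> B \<subseteq> B' \<and> \<not> B' \<subseteq> span B"
      by (intro exI[of _ "insert x B"]) blast
  qed
  then obtain F :: "nat \<Rightarrow> 'a set" where F: "\<And>n. finite (F n)" "\<And>n. F n \<subseteq> ?N"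
    "\<And>n. F n \<subseteq> F (Suc n)" "\<And>n. \<not> F (Suc n) \<subseteq> span (F n)" by blast
  have "\<exists>n. span (F (Suc n)) = span (F n)"
  proof (rule ascending_chain_stabilizes[OF C])
    fix n x assume "x \<in> span (F (Suc n))"
    then have "x \<in> ?N" using span_minimal[OF F(2) subspace_null_space_id_plus] by blast
    then show "x + C x \<in> span (F n)" by (simp add: span_0)
  qed (use F in \<open>simp_all add: closed_span_finite span_mono\<close>)
  then show False using F(4) span_superset by metis
qed

section \<open>Operators linear over the scalar field\<close>

lemma normed_space_over_real_linear:
  assumes "normed_space_over sc"
    and "\<And>x y. f (x + y) = f x + f y" "\<And>c x. f (sc c x) = sc c (f x)"
  shows "linear f"
proof -
  interpret X: normed_space_over sc by fact
  show ?thesis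
    using assms(2,3) by (intro linearI) (simp_all flip: X.scale_of_real)
qed

lemma bounded_operators_obtain:
  assumes ns: "normed_space_over sc"
    and add: "\<And>x y. f (x + y) = f x + f y" and hom: "\<And>c x. f (sc c x) = sc c (f x)"
    and bnd: "\<And>x. norm (f x) \<le> norm x * b"
  obtains F where "F \<in> bounded_operators sc" "\<And>x. blinfun_apply F x = f x"
proof -
  interpret X: normed_space_over sc by fact
  have "bounded_linear f"
    using bnd linear_scale[OF normed_space_over_real_linear[OF ns add hom]] add
    by (intro bounded_linear_intro[where K=b]) auto
  then have "blinfun_apply (Blinfun f) x = f x" for x by (simp add: bounded_linear_Blinfun_apply)
  then show thesis using that[of "Blinfun f"] hom by (simp add: bounded_operators_def)
qed

lemma bounded_operators_scale:
  "A \<in> bounded_operators sc \<Longrightarrow> A (sc c x) = sc c (A x)"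
  by (simp add: bounded_operators_def)

lemma bounded_operators_compose:
  "A \<in> bounded_operators sc \<Longrightarrow> B \<in> bounded_operators sc \<Longrightarrow> A o\<^sub>L B \<in> bounded_operators sc"
  by (simp add: bounded_operators_def)

lemma bounded_operators_id: "id_blinfun \<in> bounded_operators sc"
  by (simp add: bounded_operators_def)

lemma bounded_operators_add:
  assumes "normed_space_over sc" "A \<in> bounded_operators sc" "B \<in> bounded_operators sc"
  shows "A + B \<in> bounded_operators sc"
proof -
  interpret X: normed_space_over sc by fact
  show ?thesis
    using assms(2,3) by (simp add: bounded_operators_def blinfun.add_left X.scale_right_distrib)
qed

lemma bounded_operators_zero:
  assumes "normed_space_over sc"
  shows "0 \<in> bounded_operators sc"
proof -
  interpret X: normed_space_over sc by fact
  show ?thesis by (simp add: bounded_operators_def)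
qed

lemma funpow_id_plus_compact:
  assumes ns: "normed_space_over sc" and C: "C \<in> bounded_operators sc" "compact_operator C"
  shows "\<exists>D. D \<in> bounded_operators sc \<and> compact_operator D
    \<and> (\<forall>x. ((\<lambda>x. x + blinfun_apply C x) ^^ n) x = x + blinfun_apply D x)"
proof (induction n)
  case 0
  show ?case
    using bounded_operators_zero[OF ns] compact_operator_zero by (intro exI[of _ 0]) simp
next
  case (Suc n)
  then obtain D where D: "D \<in> bounded_operators sc" "compact_operator D"
    "\<And>x. ((\<lambda>x. x + C x) ^^ n) x = x + D x" by blast
  have "D + C + (C o\<^sub>L D) \<in> bounded_operators sc"
    using ns C D by (intro bounded_operators_add bounded_operators_compose) auto
  moreover have "compact_operator (D + C + (C o\<^sub>L D))"
    using C D by (intro compact_operator_add compact_operator_compose) auto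
  moreover have "((\<lambda>x. x + C x) ^^ Suc n) x = x + (D + C + (C o\<^sub>L D)) x" for x
    by (simp add: D(3) blinfun.bilinear_simps add.assoc)
  ultimately show ?case by blast
qed

section \<open>Inverses modulo finite rank and generalized inverses\<close>

text \<open>
  With \<open>L = I + C\<close> and \<open>M = L\<^sup>n\<close> for \<open>n\<close> so large that null spaces and ranges of the powers of \<open>L\<close> no
  longer change, \<open>M\<close> is injective on its range and maps it onto itself. Hence each \<open>x\<close> has exactly one
  \<open>f x\<close> in the range of \<open>M\<close> with \<open>M (M (f x)) = M x\<close>, and uniqueness makes \<open>f\<close> linear. The
  difference \<open>x - M (f x)\<close> lies in the null space of \<open>M\<close>, which has finite dimension, and
  \<open>M f = L V\<close> for \<open>V = L\<^sup>n\<^sup>-\<^sup>1 f\<close>. The operator \<open>f\<close> is bounded because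
  \<open>M\<close> is again the identity plus a compact operator and therefore bounded below on the unit vectors
  of its range.
\<close>

lemma parametrix_id_plus_compact:
  assumes ns: "normed_space_over sc" and C: "C \<in> bounded_operators sc" "compact_operator C"
  obtains V B where "V \<in> bounded_operators sc" "finite B" "\<And>x. x - (V x + C (V x)) \<in> span B"
proof -
  interpret X: normed_space_over sc by fact
  define L where "L = (\<lambda>x. x + blinfun_apply C x)"
  have "\<exists>D. \<forall>n. D n \<in> bounded_operators sc \<and> compact_operator (D n)
      \<and> (\<forall>x. (L ^^ n) x = x + blinfun_apply (D n) x)"
    using funpow_id_plus_compact[OF ns C] unfolding L_def by (intro choice) blast
  then obtain D where D: "\<And>n. D n \<in> bounded_operators sc" "\<And>n. compact_operator (D n)"
    and LD: "\<And>n x. (L ^^ n) x = x + blinfun_apply (D n) x" by blast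
  have lin: "linear (L ^^ n)" for n
    by (rule linearI) (simp_all add: LD blinfun.bilinear_simps algebra_simps)
  define N where "N n = {x. (L ^^ n) x = 0}" for n
  define R where "R n = range (L ^^ n)" for n
  have N_Suc: "x \<in> N (Suc n) \<longleftrightarrow> L x \<in> N n" for n x
    by (simp add: N_def funpow_Suc_right del: funpow.simps)
  have R_Suc: "R (Suc n) = L ` R n" for n by (auto simp: R_def)
  have "\<exists>n. N (Suc n) = N n"
  proof (rule ascending_chain_stabilizes[OF C(2)])
    fix n
    show "closed (N n)" unfolding N_def LD by (rule closed_null_space_id_plus)
    show "subspace (N n)" unfolding N_def LD by (rule subspace_null_space_id_plus)
    show "N n \<subseteq> N (Suc n)" by (auto simp: N_def L_def)
    show "x + C x \<in> N n" if "x \<in> N (Suc n)" for x using that N_Suc by (simp add: L_def)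
  qed
  then obtain p where "N (Suc p) = N p" by blast
  then have Np: "N (p + k) = N p" for k
  proof (induction k)
    case (Suc k)
    have "x \<in> N (Suc (p + k)) \<longleftrightarrow> x \<in> N p" for x
      using Suc.IH[OF Suc.prems] Suc.prems N_Suc by metis
    then show ?case by auto
  qed simp
  have "\<exists>n. R (Suc n) = R n"
  proof (rule descending_chain_stabilizes[OF C(2)])
    fix n
    have "(L ^^ n) = (\<lambda>x. x + D n x)" using LD by blast
    then show "closed (R n)"
      unfolding R_def using closed_range_id_plus_compact[OF D(2)] by metis
    show "subspace (R n)" unfolding R_def by (rule linear_subspace_image[OF lin subspace_UNIV])
    show "R (Suc n) \<subseteq> R n" by (auto simp: R_def funpow_Suc_right simp del: funpow.simps)
    show "x + C x \<in> R (Suc n)" if "x \<in> R n" for x using that R_Suc by (auto simp: L_def)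
  qed
  then obtain q where "R (Suc q) = R q" by blast
  then have Rq: "R (q + k) = R q" for k
    by (induction k) (simp_all add: R_Suc)
  \<comment> \<open>The successor guarantees a positive exponent, so that one factor \<open>L\<close> can be split off \<open>M\<close>.\<close>
  define m where "m = max p q"
  define M where "M = L ^^ Suc m"
  have M: "M x = x + D (Suc m) x" for x by (simp only: M_def LD)
  have linM: "linear M" unfolding M_def by (rule lin)
  have subspace_range: "subspace (range M)" by (rule linear_subspace_image[OF linM subspace_UNIV])
  have MM: "M (M x) = (L ^^ (Suc m + Suc m)) x" for x by (simp only: M_def funpow_add o_apply)
  have "N (Suc m + Suc m) = N (Suc m)"
    using Np[of "Suc m - p"] Np[of "Suc m + Suc m - p"] by (simp add: m_def)
  then have inj: "M x = 0" if "M (M x) = 0" for x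
    using that unfolding MM by (auto simp: N_def M_def simp del: funpow.simps)
  have "R (Suc m + Suc m) = R (Suc m)"
    using Rq[of "Suc m - q"] Rq[of "Suc m + Suc m - q"] by (simp add: m_def)
  then have "range (\<lambda>x. M (M x)) = range M"
    unfolding MM by (simp only: R_def M_def)
  then have surj: "\<exists>w. M x = M (M w)" for x by (metis rangeE rangeI)
  let ?F = "range M \<inter> {u. norm u = 1}"
  have "closed (range M)"
    using closed_range_id_plus_compact[OF D(2)[of "Suc m"]] unfolding M .
  then have "closed ?F" by (intro closed_Int closed_Collect_eq continuous_intros)
  moreover have "bounded ?F" by (rule bounded_subset[OF bounded_cball[of 0 1]]) auto
  moreover have "x + D (Suc m) x \<noteq> 0" if xF: "x \<in> ?F" for x
  proof -
    obtain w where "x = M w" "norm (M w) = 1" using xF by blast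
    then show ?thesis using inj[of w] by (auto simp flip: M)
  qed
  ultimately obtain c where c: "0 < c" "\<And>x. x \<in> ?F \<Longrightarrow> c \<le> norm (x + D (Suc m) x)"
    using id_plus_compact_bounded_below[OF D(2)] by blast
  have below: "c * norm y \<le> norm (M y)" if "y \<in> range M" for y
  proof (cases "y = 0")
    case False
    have "inverse (norm y) *\<^sub>R y \<in> range M"
      using that subspace_range by (simp add: subspace_scale)
    then have "c \<le> norm (M (inverse (norm y) *\<^sub>R y))"
      using c(2)[of "inverse (norm y) *\<^sub>R y"] False by (simp add: M)
    then show ?thesis using False by (simp add: linear_scale[OF linM] field_simps)
  qed simp
  have "\<exists>y. y \<in> range M \<and> M (M y) = M x" for x using surj by (metis rangeI)
  then obtain f where f: "\<And>x. f x \<in> range M" "\<And>x. M (M (f x)) = M x" by metis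
  have unique: "y = f x" if y: "y \<in> range M" "M (M y) = M x" for x y
  proof -
    obtain v w where "y = M v" "f x = M w" using y(1) f(1) by blast
    then have "M (M (M (v - w))) = 0" using y(2) f(2)[of x] by (simp add: linear_diff[OF linM])
    then have "M (v - w) = 0" using inj by blast
    then show ?thesis using \<open>y = M v\<close> \<open>f x = M w\<close> by (simp add: linear_diff[OF linM])
  qed
  have homM: "M (sc a x) = sc a (M x)" for a x
    by (simp add: M bounded_operators_scale[OF D(1)] X.scale_right_distrib)
  have add: "f (x + y) = f x + f y" for x y
  proof (rule sym, rule unique)
    show "f x + f y \<in> range M" using f(1) subspace_range by (simp add: subspace_add)
  qed (simp add: linear_add[OF linM] f)
  have hom: "f (sc a x) = sc a (f x)" for a x
  proof (rule sym, rule unique)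
    show "sc a (f x) \<in> range M" using f(1)[of x] by (auto simp flip: homM)
  qed (simp add: homM f)
  have bound: "norm (f x) \<le> norm x * ((1 + norm (D (Suc m))) / (c * c))" for x
  proof -
    have "c * (c * norm (f x)) \<le> c * norm (M (f x))" using below[OF f(1)] c(1) by simp
    also have "\<dots> \<le> norm (M x)" using below[of "M (f x)"] f(2) by simp
    also have "\<dots> \<le> norm x + norm (D (Suc m)) * norm x"
      unfolding M by (meson add_left_mono norm_blinfun norm_triangle_le)
    finally show ?thesis using c(1) by (simp add: field_simps)
  qed
  obtain F where F: "F \<in> bounded_operators sc" "\<And>x. blinfun_apply F x = f x"
    using bounded_operators_obtain[OF ns add hom bound] by blast
  obtain B where B: "finite B" "{x. x + D (Suc m) x = 0} \<subseteq> span B"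
    using finite_dimensional_null_space_id_plus_compact[OF D(2)] by blast
  show thesis
  proof (rule that[OF _ B(1)])
    show "(id_blinfun + D m) o\<^sub>L F \<in> bounded_operators sc"
      using ns F D by (intro bounded_operators_add bounded_operators_compose bounded_operators_id) auto
    fix x
    have "((id_blinfun + D m) o\<^sub>L F) x = (L ^^ m) (f x)"
      by (simp add: LD F blinfun.bilinear_simps)
    then have "x - (((id_blinfun + D m) o\<^sub>L F) x + C (((id_blinfun + D m) o\<^sub>L F) x)) = x - M (f x)"
      by (simp add: M_def L_def)
    moreover have "x - M (f x) \<in> span B"
    proof -
      have "M (x - M (f x)) = 0" by (simp add: linear_diff[OF linM] f)
      then show ?thesis using B(2) unfolding M[symmetric] by blast
    qed
    ultimately show "x - (((id_blinfun + D m) o\<^sub>L F) x + C (((id_blinfun + D m) o\<^sub>L F) x)) \<in> span B"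
      by (simp only:)
  qed
qed

text \<open>
  The error \<open>Q = I - A S V\<close> of the approximate inverse \<open>S V\<close> is corrected by \<open>g Q\<close>: on the range of
  \<open>A\<close>, \<open>Q\<close> takes values in that range, where \<open>g\<close> is a right inverse of \<open>A\<close>. The map \<open>g\<close> comes from
  linear algebra over the scalar field; \<open>g Q\<close> is bounded because every linear map is bounded on
  a finite-dimensional space containing the range of \<open>Q\<close>.
\<close>

lemma generalized_inverse_exists:
  assumes ns: "normed_space_over sc" and A: "A \<in> bounded_operators sc"
    and S: "S \<in> bounded_operators sc" and C: "C \<in> bounded_operators sc" "compact_operator C"
    and AS: "A o\<^sub>L S = id_blinfun + C"
  obtains G where "G \<in> bounded_operators sc" "\<And>x. A (G (A x)) = A x"
proof -
  interpret X: normed_space_over sc by fact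
  interpret XX: vector_space_pair sc sc by unfold_locales
  obtain V B where V: "V \<in> bounded_operators sc" and B: "finite B"
    and "\<And>x. x - (V x + C (V x)) \<in> span B"
    using parametrix_id_plus_compact[OF ns C] by blast
  moreover have AS': "A (S x) = x + C x" for x
    using arg_cong[OF AS, of "\<lambda>U. blinfun_apply U x"] by (simp add: blinfun.add_left)
  ultimately have P: "x - A (S (V x)) \<in> span B" for x by simp
  have "Vector_Spaces.linear sc sc A"
    by unfold_locales (simp_all add: blinfun.add_right bounded_operators_scale[OF A])
  then obtain g where g: "Vector_Spaces.linear sc sc g" "\<And>x. A (g (A x)) = A x"
    using XX.linear_exists_right_inverse_on[OF _ X.subspace_UNIV, of A] by auto
  have g_add: "g (x + y) = g x + g y" and g_hom: "g (sc a x) = sc a (g x)" for a x y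
    using g(1) by (simp_all add: XX.linear_add XX.linear_scale)
  then have "linear g" by (rule normed_space_over_real_linear[OF ns])
  then obtain c where c: "0 \<le> c" "\<And>x. x \<in> span B \<Longrightarrow> norm (g x) \<le> c * norm x"
    using linear_bounded_on_finite_span[OF B] by blast
  define Q where "Q = id_blinfun - (A o\<^sub>L S o\<^sub>L V)"
  have Q: "Q x = x - A (S (V x))" for x by (simp add: Q_def blinfun.diff_left)
  have Q_hom: "Q (sc a x) = sc a (Q x)" for a x
    by (simp add: Q bounded_operators_scale[OF A] bounded_operators_scale[OF S]
        bounded_operators_scale[OF V] X.scale_right_diff_distrib)
  have "norm (g (Q x)) \<le> norm x * (c * norm Q)" for x
  proof -
    have "norm (g (Q x)) \<le> c * norm (Q x)" using c(2) P Q by simp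
    also have "\<dots> \<le> c * (norm Q * norm x)" using c(1) by (intro mult_left_mono norm_blinfun)
    finally show ?thesis by (simp add: ac_simps)
  qed
  then obtain H where H: "H \<in> bounded_operators sc" "\<And>x. blinfun_apply H x = g (Q x)"
    using bounded_operators_obtain[OF ns, of "\<lambda>x. g (Q x)"]
    by (metis (no_types, lifting) Q_hom blinfun.add_right g_add g_hom)
  show thesis
  proof (rule that)
    show "(S o\<^sub>L V) + H \<in> bounded_operators sc"
      using ns S V H by (intro bounded_operators_add bounded_operators_compose)
    fix x
    have "Q (A x) = A (x - S (V (A x)))" by (simp add: Q blinfun.diff_right)
    then have "A (H (A x)) = Q (A x)" using g(2) H(2) by simp
    then show "A (((S o\<^sub>L V) + H) (A x)) = A x"
      by (simp add: Q blinfun.add_left blinfun.add_right)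
  qed
qed

section \<open>Complements from a generalized inverse\<close>

lemma complemented_by_idempotent:
  assumes ns: "normed_space_over sc" and Y: "closed Y" "module.subspace sc Y"
    and E: "E \<in> bounded_operators sc" "\<And>x. x \<in> Y \<Longrightarrow> E x \<in> Y" "\<And>x. x \<in> Y \<Longrightarrow> E (E x) = E x"
  shows "complemented_subspace sc Y {x \<in> Y. E x = x}"
    and "complemented_subspace sc Y {x \<in> Y. E x = 0}"
proof -
  interpret X: normed_space_over sc by fact
  note Y_closure = X.subspace_0[OF Y(2)] X.subspace_add[OF Y(2)] X.subspace_scale[OF Y(2)]
    X.subspace_diff[OF Y(2)]
  let ?I = "{x \<in> Y. E x = x}" and ?K = "{x \<in> Y. E x = 0}"
  have "?I = Y \<inter> {x. E x = x}" "?K = Y \<inter> {x. E x = 0}" by auto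
  moreover have "closed (Y \<inter> {x. E x = x})" "closed (Y \<inter> {x. E x = 0})"
    by (intro closed_Int Y closed_Collect_eq continuous_intros)+
  ultimately have closed: "closed_subspace sc Y ?I" "closed_subspace sc Y ?K"
    using Y_closure by (auto simp: closed_subspace_def X.subspace_def blinfun.add_right
        bounded_operators_scale[OF E(1)])
  have decomposition: "\<exists>y z. x = y + z \<and> y \<in> ?I \<and> z \<in> ?K" if "x \<in> Y" for x
    using that E(2,3) Y_closure(4)
    by (intro exI[of _ "E x"] exI[of _ "x - E x"]) (auto simp: blinfun.diff_right)
  have "{x + y | x y. x \<in> ?I \<and> y \<in> ?K} = Y"
  proof
    show "{x + y | x y. x \<in> ?I \<and> y \<in> ?K} \<subseteq> Y" using Y_closure(2) by auto
    show "Y \<subseteq> {x + y | x y. x \<in> ?I \<and> y \<in> ?K}" using decomposition by blast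
  qed
  moreover have "{x + y | x y. x \<in> ?K \<and> y \<in> ?I} = Y"
  proof
    show "{x + y | x y. x \<in> ?K \<and> y \<in> ?I} \<subseteq> Y" using Y_closure(2) by auto
    show "Y \<subseteq> {x + y | x y. x \<in> ?K \<and> y \<in> ?I}"
    proof
      fix x assume "x \<in> Y"
      then obtain y z where "x = y + z" "y \<in> ?I" "z \<in> ?K" using decomposition by blast
      moreover from this have "x = z + y" by (simp only: add.commute)
      ultimately show "x \<in> {x + y | x y. x \<in> ?K \<and> y \<in> ?I}" by blast
    qed
  qed
  moreover have "?I \<inter> ?K = {0}" "?K \<inter> ?I = {0}" using Y_closure(1) by auto
  ultimately show "complemented_subspace sc Y ?I" "complemented_subspace sc Y ?K"
    unfolding complemented_subspace_def using closed by blast+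
qed

text \<open>
  On \<open>Y\<close>, \<open>A G\<close> and \<open>G A\<close> are idempotent; the range of \<open>A\<close> is the set of fixed points of \<open>A G\<close> and
  its kernel is that of \<open>G A\<close>. The invariant carrier \<open>Y\<close> lets the same statement serve the space
  and its dual.
\<close>

lemma range_kernel_complemented_by_generalized_inverse:
  assumes ns: "normed_space_over sc" and Y: "closed Y" "module.subspace sc Y"
    and A: "A \<in> bounded_operators sc" "\<And>x. x \<in> Y \<Longrightarrow> A x \<in> Y"
    and G: "G \<in> bounded_operators sc" "\<And>x. x \<in> Y \<Longrightarrow> G x \<in> Y"
    and AGA: "\<And>x. x \<in> Y \<Longrightarrow> A (G (A x)) = A x"
  shows "closed (range_on Y A)"
    and "complemented_subspace sc Y (range_on Y A)"
    and "complemented_subspace sc Y (kernel_on Y A)"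
proof -
  have "range_on Y A = {x \<in> Y. (A o\<^sub>L G) x = x}"
    using A G AGA by (auto simp: range_on_def) (metis imageI)
  then show range: "complemented_subspace sc Y (range_on Y A)"
    using complemented_by_idempotent(1)[OF ns Y bounded_operators_compose[OF A(1) G(1)]] A G AGA
    by simp
  then show "closed (range_on Y A)" by (simp add: complemented_subspace_def closed_subspace_def)
  have "kernel_on Y A = {x \<in> Y. (G o\<^sub>L A) x = 0}"
    using AGA by (auto simp: kernel_on_def) (metis blinfun.zero_right)
  then show "complemented_subspace sc Y (kernel_on Y A)"
    using complemented_by_idempotent(2)[OF ns Y bounded_operators_compose[OF G(1) A(1)]] A G AGA
    by simp
qed

theorem corollary5p4:
  fixes sc :: "'k::real_normed_field \<Rightarrow> 'a::banach \<Rightarrow> 'a"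
    and T K :: "'a \<Rightarrow>\<^sub>L 'a"
  assumes "normed_space_over sc"
    and "T \<in> bounded_operators sc" and "K \<in> bounded_operators sc"
    and "right_semi_Fredholm sc T" and "compact_operator K"
  shows "complemented_subspace sc UNIV (closure (range_on UNIV (T + K))) \<and>
    complemented_subspace sc UNIV (kernel_on UNIV (T + K)) \<and>
    complemented_subspace dual_scale (dual_space sc)
      (closure (range_on (dual_space sc) (adjoint_operator T + adjoint_operator K))) \<and>
    complemented_subspace dual_scale (dual_space sc)
      (kernel_on (dual_space sc) (adjoint_operator T + adjoint_operator K)) \<and>
    closed (range_on UNIV (T + K)) \<and>
    closed (range_on (dual_space sc) (adjoint_operator T + adjoint_operator K))"
proof -
  interpret X: normed_space_over sc by fact
  obtain S C where S: "S \<in> bounded_operators sc" and C: "C \<in> bounded_operators sc" "compact_operator C"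
    and TS: "T o\<^sub>L S = id_blinfun + C"
    using assms(4) by (auto simp: right_semi_Fredholm_def)
  have A: "T + K \<in> bounded_operators sc" using assms by (intro bounded_operators_add)
  have C': "C + (K o\<^sub>L S) \<in> bounded_operators sc" "compact_operator (C + (K o\<^sub>L S))"
    using assms S C
    by (auto intro!: bounded_operators_add bounded_operators_compose compact_operator_add
        compact_operator_compose)
  have "(T + K) o\<^sub>L S = id_blinfun + (C + (K o\<^sub>L S))"
  proof (rule blinfun_eqI)
    fix x
    have "T (S x) = x + C x"
      using arg_cong[OF TS, of "\<lambda>U. blinfun_apply U x"] by (simp add: blinfun.add_left)
    then show "((T + K) o\<^sub>L S) x = (id_blinfun + (C + (K o\<^sub>L S))) x"
      by (simp add: blinfun.add_left)
  qed
  then obtain G where G: "G \<in> bounded_operators sc" "\<And>x. (T + K) (G ((T + K) x)) = (T + K) x"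
    using generalized_inverse_exists[OF assms(1) A S C'] by blast
  have adj: "adjoint_operator T + adjoint_operator K
      = (adjoint_operator (T + K) :: ('a \<Rightarrow>\<^sub>L 'k) \<Rightarrow>\<^sub>L ('a \<Rightarrow>\<^sub>L 'k))"
    by (intro blinfun_eqI) (simp add: blinfun.add_left blinfun.add_right)
  have dual_AGA: "adjoint_operator (T + K) (adjoint_operator G (adjoint_operator (T + K) f))
      = adjoint_operator (T + K) f" for f :: "'a \<Rightarrow>\<^sub>L 'k"
    by (rule blinfun_eqI) (simp add: G(2))
  note space = range_kernel_complemented_by_generalized_inverse
    [OF assms(1) closed_UNIV X.subspace_UNIV A _ G(1) _ G(2)]
  note dual = range_kernel_complemented_by_generalized_inverse
    [OF normed_space_over_dual_scale closed_dual_space subspace_dual_space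
      adjoint_operator_bounded_operators adjoint_operator_dual_space[OF A]
      adjoint_operator_bounded_operators adjoint_operator_dual_space[OF G(1)] dual_AGA]
  show ?thesis
    unfolding adj using space dual by (simp add: closure_closed)
qed

end
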